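(* For integers $k \geq 3$ and $n \geq 6$, $$ gr_{k}(K_{3} : W_{n}) \leq (n - 4)^{2} \cdot 30^{k} + k(n - 1). $$
   Context: For $n \geq 4$, the wheel $W_n$ is the graph of order $n$ given by $W_n = K_1 \vee C_{n-1}$, i.e., a cycle on $n-1$ vertices together with one additional vertex adjacent to all vertices of the cycle. For graphs $G$, $H$ and a positive integer $k$, the Gallai-Ramsey number $gr_k(G:H)$ is the minimum integer $m$ such that every coloring of the edges of $K_m$ using at most $k$ colors contains either a rainbow copy of $G$ (all edges receiving distinct colors) or a monochromatic copy of $H$. *)

theory Defs
  imports "HOL-Library.Ramsey" "HOL-Library.Extended_Nat"
begin

record 'a ugraph =
  verts :: "'a set"
  edges :: "'a set set"

definition complete_graph :: "nat \<Rightarrow> nat ugraph" where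
  "complete_graph m = \<lparr>verts = {..<m}, edges = nsets {..<m} 2\<rparr>"

text \<open>A cycle only for \<open>m \<ge> 3\<close>.\<close>

definition cycle_graph :: "nat \<Rightarrow> nat ugraph" where
  "cycle_graph m = \<lparr>verts = {..<m}, edges = (\<lambda>i. {i, (i + 1) mod m}) ` {..<m}\<rparr>"

definition graph_join :: "'a ugraph \<Rightarrow> 'b ugraph \<Rightarrow> ('a + 'b) ugraph" where
  "graph_join G H =
    \<lparr>verts = verts G <+> verts H,
     edges = (`) Inl ` edges G \<union> (`) Inr ` edges H
       \<union> {{Inl u, Inr v} | u v. u \<in> verts G \<and> v \<in> verts H}\<rparr>"

definition wheel_graph :: "nat \<Rightarrow> (nat + nat) ugraph" where
  "wheel_graph n = graph_join (complete_graph 1) (cycle_graph (n - 1))"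

text \<open>\<open>f\<close> maps \<open>G\<close> onto a (not necessarily induced) subgraph of \<open>H\<close> isomorphic to \<open>G\<close>.\<close>

definition is_copy :: "('a \<Rightarrow> 'b) \<Rightarrow> 'a ugraph \<Rightarrow> 'b ugraph \<Rightarrow> bool" where
  "is_copy f G H \<longleftrightarrow>
    inj_on f (verts G) \<and> f ` verts G \<subseteq> verts H \<and> (\<forall>e\<in>edges G. f ` e \<in> edges H)"

definition edge_coloring :: "'b ugraph \<Rightarrow> nat \<Rightarrow> ('b set \<Rightarrow> nat) \<Rightarrow> bool" where
  "edge_coloring K k c \<longleftrightarrow> c ` edges K \<subseteq> {..<k}"

definition has_rainbow_copy :: "'b ugraph \<Rightarrow> ('b set \<Rightarrow> nat) \<Rightarrow> 'a ugraph \<Rightarrow> bool" where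
  "has_rainbow_copy K c G \<longleftrightarrow>
    (\<exists>f. is_copy f G K \<and> inj_on (\<lambda>e. c (f ` e)) (edges G))"

definition has_monochromatic_copy :: "'b ugraph \<Rightarrow> ('b set \<Rightarrow> nat) \<Rightarrow> 'a ugraph \<Rightarrow> bool" where
  "has_monochromatic_copy K c H \<longleftrightarrow>
    (\<exists>f i. is_copy f H K \<and> (\<forall>e\<in>edges H. c (f ` e) = i))"

text \<open>The minimum is taken in \<^typ>\<open>enat\<close>, so that it is \<open>\<infinity>\<close> if no such \<open>m\<close> exists; a finite
  upper bound thus includes existence.\<close>

definition gallai_ramsey :: "nat \<Rightarrow> 'a ugraph \<Rightarrow> 'b ugraph \<Rightarrow> enat" where
  "gallai_ramsey k G H =
    Inf {enat m | m. \<forall>c. edge_coloring (complete_graph m) k c \<longrightarrow>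
      has_rainbow_copy (complete_graph m) c G \<or> has_monochromatic_copy (complete_graph m) c H}"

end

theory Submission
  imports Defs
begin

text \<open>
  Put \<open>l = n - 1\<close>. By Gallai's theorem, a set \<open>S\<close> of vertices contains either a set at least about
  a third as large that is joined in a single colour to \<open>l\<close> other vertices of \<open>S\<close>, or a set almost
  as large as \<open>S\<close> that is two-coloured up to \<open>l\<close> edges at each vertex. If there is no monochromatic
  wheel, a colour can be responsible for the first outcome at most twice: after the second time it
  no longer occurs. So the descent costs a factor of at most 9 per colour. It ends in a set that is
  essentially two-coloured, where a linear bound for the Ramsey number of wheels applies; if both
  colours are still unused, at least four factors of 3 have been saved to pay for it.

  For two colours, take a hub of large degree, say in red. If most vertices of its red neighbourhood
  have small red degree there, blue is dense and contains a wheel. Otherwise many pairs of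
  vertices have many common red neighbours, and there is a linear-sized set \<open>U\<close> in which any two
  vertices are joined by red paths of every required even length. This gives even cycles, and odd
  ones as soon as \<open>U\<close> contains a red edge; if it contains none, \<open>U\<close> is almost entirely blue.
\<close>

section \<open>Cycles from common neighbours\<close>

text \<open>For symmetric \<open>E\<close> and \<open>l\<close> at least 3 this is an ordinary
  cycle, cut open into a list; for \<open>l = 2\<close> it degenerates to one edge used both
  ways.\<close>

definition has_cycle :: "('a \<Rightarrow> 'a \<Rightarrow> bool) \<Rightarrow> 'a set \<Rightarrow> nat \<Rightarrow> bool" where
  "has_cycle E S l \<longleftrightarrow> (\<exists>xs. length xs = l \<and> distinct xs \<and> set xs \<subseteq> S \<and>
     successively E xs \<and> E (last xs) (hd xs))"

lemma has_cycle_mono: "has_cycle E S l \<Longrightarrow> S \<subseteq> S' \<Longrightarrow> has_cycle E S' l"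
  unfolding has_cycle_def by blast

lemma ex_outside_of_card_less:
  assumes "finite B" and "card B < card A"
  shows "\<exists>z\<in>A. z \<notin> B"
  using assms by (metis card_mono not_less subsetI)

lemma path_extend:
  assumes common: "\<And>x y. x \<in> U \<Longrightarrow> y \<in> U \<Longrightarrow> m \<le> card {z \<in> U. H x z \<and> H z y}"
    and xs: "successively H xs" "distinct xs" "set xs \<subseteq> U" "2 \<le> length xs"
    and q: "length xs \<le> q" "q \<le> m"
  shows "\<exists>ys. successively H ys \<and> distinct ys \<and> set ys \<subseteq> U \<and> length ys = q \<and>
    hd ys = hd xs \<and> last ys = last xs"
  using q
proof (induction q rule: dec_induct)
  case base
  then show ?case using xs by blast
next
  case (step q)
  then obtain ys where ys: "successively H ys" "distinct ys" "set ys \<subseteq> U" "length ys = q"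
    "hd ys = hd xs" "last ys = last xs" by auto
  have "2 \<le> length ys" using ys step xs by linarith
  then obtain x y zs where [simp]: "ys = x # y # zs"
    by (metis One_nat_def Suc_1 Suc_le_length_iff)
  have "card (set ys) < card {z \<in> U. H x z \<and> H z y}"
    using common[of x y] ys step distinct_card[of ys] by fastforce
  then obtain z where z: "z \<in> U" "H x z" "H z y" "z \<notin> set ys"
    using ex_outside_of_card_less[of "set ys"] by blast
  show ?case
    by (rule exI[of _ "x # z # y # zs"]) (use ys z in auto)
qed

text \<open>A fresh common neighbour goes between any two consecutive vertices. The reserved set
  \<open>F\<close> keeps the vertices inserted in the tail apart from the heads that the induction
  adds later.\<close>

lemma path_subdivide:
  assumes "successively (\<lambda>x y. D \<le> card {z \<in> S. E x z \<and> E z y}) xs" "distinct xs" "xs \<noteq> []"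
    "set xs \<subseteq> F" "set xs \<subseteq> S" "finite F" "card F + length xs \<le> D + 1"
  shows "\<exists>zs. successively E zs \<and> distinct zs \<and> set zs \<subseteq> S \<and> length zs + 1 = 2 * length xs \<and>
    hd zs = hd xs \<and> last zs = last xs \<and> set zs \<inter> F = set xs"
  using assms
proof (induction xs rule: induct_list012)
  case 1
  then show ?case by simp
next
  case (2 x)
  then show ?case by (intro exI[of _ "[x]"]) auto
next
  case (3 x x' xs)
  then obtain zs where zs: "successively E zs" "distinct zs" "set zs \<subseteq> S"
    "length zs + 1 = 2 * length (x' # xs)" "hd zs = x'" "last zs = last (x' # xs)"
    "set zs \<inter> F = set (x' # xs)"
    by auto
  have "card (set zs) = card (set zs \<inter> F) + card (set zs - F)"
    by (metis List.finite_set card_Int_Diff)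
  moreover have "card (set zs \<inter> F) = length (x' # xs)"
    using zs(7) "3.prems"(2) distinct_card[of "x' # xs"] by simp
  \<comment> \<open>Outside \<open>F\<close> lie just the vertices inserted so far, one per edge of
    the tail. Together with \<open>F\<close> they number less than \<open>D\<close>, so another
    common neighbour is free.\<close>
  ultimately have c: "card (set zs - F) + 1 = length (x' # xs)"
    using zs(2,4) distinct_card[of zs] by linarith
  have "card (F \<union> set zs) \<le> card F + card (set zs - F)"
    by (metis card_Un_le Un_Diff_cancel)
  also have "\<dots> < D" using c "3.prems"(7) by simp
  also have "D \<le> card {z \<in> S. E x z \<and> E z x'}" using "3.prems"(1) by simp
  finally obtain z where z: "z \<in> S" "E x z" "E z x'" "z \<notin> F" "z \<notin> set zs"
    using ex_outside_of_card_less[of "F \<union> set zs"] "3.prems"(6) by blast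
  have x: "x \<notin> set zs" "x \<in> F" "x \<in> S" using zs(7) "3.prems" by auto
  have ne: "zs \<noteq> []" using zs(4) by auto
  show ?case
    by (rule exI[of _ "x # z # zs"])
      (use zs z x ne in \<open>auto simp: successively_Cons\<close>)
qed

text \<open>An \<open>H\<close>-path, where \<open>H\<close> relates vertices with many common neighbours, subdivides to a path of
  roughly twice its length. A common neighbour of its ends closes an even cycle, an edge between
  its ends an odd one.\<close>

lemma has_cycle_of_common_neighbours:
  fixes l :: nat
  assumes fin: "finite S" and US: "U \<subseteq> S" "U \<noteq> {}" and l: "5 \<le> l"
    and symE: "symp E"
    and H: "\<And>x y. H x y \<longleftrightarrow> x \<noteq> y \<and> l \<le> card {z \<in> S. E x z \<and> E z y}"
    and common: "\<And>x y. x \<in> U \<Longrightarrow> y \<in> U \<Longrightarrow> l \<le> card {z \<in> U. H x z \<and> H z y}"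
    and odd: "odd l \<Longrightarrow> \<exists>x\<in>U. \<exists>y\<in>U. x \<noteq> y \<and> E x y"
  shows "has_cycle E S l"
proof -
  have subdiv: "\<exists>zs. successively E zs \<and> distinct zs \<and> set zs \<subseteq> S \<and> length zs + 1 = 2 * length xs \<and>
      hd zs = hd xs \<and> last zs = last xs"
    if "successively H xs" "distinct xs" "set xs \<subseteq> U" "xs \<noteq> []" "2 * length xs \<le> l + 1" for xs
  proof -
    have "successively (\<lambda>x y. l \<le> card {z \<in> S. E x z \<and> E z y}) xs"
      using that(1) by (rule successively_mono) (simp add: H)
    moreover have "set xs \<subseteq> S" "card (set xs) + length xs \<le> l + 1"
      using that US distinct_card[OF that(2)] by auto
    ultimately show ?thesis
      using path_subdivide[OF _ that(2,4) subset_refl] by blast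
  qed
  obtain u where u: "u \<in> U" using US by blast
  show ?thesis
  proof (cases "even l")
    case True
    then obtain t where t: "l = 2 * t" by blast
    have "0 < card {z \<in> U. H u z \<and> H z u}" using common[OF u u] l by linarith
    then obtain v where v: "v \<in> U" "H u v" by (auto simp: card_gt_0_iff)
    have "u \<noteq> v" using v H by blast
    from path_extend[OF common, of "[u, v]" t] obtain xs where
      xs: "successively H xs" "distinct xs" "set xs \<subseteq> U" "length xs = t" "hd xs = u" "last xs = v"
      using u v \<open>u \<noteq> v\<close> t l by auto
    from subdiv[OF xs(1-3)] xs(4-) t l obtain zs where
      zs: "successively E zs" "distinct zs" "set zs \<subseteq> S" "length zs + 1 = l" "hd zs = u" "last zs = v"
      by fastforce
    have "card (set zs) < card {z \<in> S. E u z \<and> E z v}"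
      using zs v H distinct_card[OF zs(2)] by fastforce
    then obtain y where y: "y \<in> S" "E u y" "E y v" "y \<notin> set zs"
      using ex_outside_of_card_less[of "set zs"] by blast
    have "zs \<noteq> []" using zs(4) l by auto
    then show ?thesis unfolding has_cycle_def
      by (intro exI[of _ "y # zs"])
        (use zs y symE in \<open>auto simp: successively_Cons dest: sympD\<close>)
  next
    case False
    then obtain t where t: "l = 2 * t + 1" by (auto elim: oddE)
    obtain x y where xy: "x \<in> U" "y \<in> U" "x \<noteq> y" "E x y" using odd False by blast
    have "0 < card {z \<in> U. H x z \<and> H z y}" using common[OF xy(1,2)] l by linarith
    then obtain w where w: "w \<in> U" "H x w" "H w y" by (auto simp: card_gt_0_iff)
    \<comment> \<open>The ends \<open>x\<close> and \<open>y\<close> need not be related by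
      \<open>H\<close>, hence the start with three vertices. After subdivision there are
      \<open>2 * t + 1 = l\<close> vertices.\<close>
    from path_extend[OF common, of "[x, w, y]" "t + 1"] obtain xs where
      xs: "successively H xs" "distinct xs" "set xs \<subseteq> U" "length xs = t + 1" "hd xs = x" "last xs = y"
      using xy w H t l by auto
    have "xs \<noteq> []" using xs(4) by auto
    from subdiv[OF xs(1-3) this] xs(4-) t l obtain zs where
      zs: "successively E zs" "distinct zs" "set zs \<subseteq> S" "length zs = l" "hd zs = x" "last zs = y"
      by fastforce
    then show ?thesis unfolding has_cycle_def
      using xy symE by (intro exI[of _ zs]) (auto dest: sympD)
  qed
qed

text \<open>Any two vertices of \<open>Q\<close> have all of \<open>T\<close> as common neighbours,
  so \<open>H\<close> is complete on \<open>Q\<close>. The two extra vertices of \<open>Q\<close>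
  make up for excluding \<open>x\<close> and \<open>y\<close> themselves.\<close>

lemma has_cycle_bipartite:
  fixes l :: nat
  assumes fin: "finite T" "finite Q" and T: "l \<le> card T" and Q: "l + 2 \<le> card Q" and l: "5 \<le> l"
    and symE: "symp E" and TQ: "\<And>x y. x \<in> T \<Longrightarrow> y \<in> Q \<Longrightarrow> E x y"
    and odd: "odd l \<Longrightarrow> \<exists>x\<in>Q. \<exists>y\<in>Q. x \<noteq> y \<and> E x y"
  shows "has_cycle E (T \<union> Q) l"
proof (rule has_cycle_of_common_neighbours[where U = Q])
  define H where "H = (\<lambda>x y. x \<noteq> y \<and> l \<le> card {z \<in> T \<union> Q. E x z \<and> E z y})"
  show "H x y \<longleftrightarrow> x \<noteq> y \<and> l \<le> card {z \<in> T \<union> Q. E x z \<and> E z y}" for x y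
    by (simp add: H_def)
  have Hxy: "H x y" if "x \<in> Q" "y \<in> Q" "x \<noteq> y" for x y
  proof -
    have "T \<subseteq> {z \<in> T \<union> Q. E x z \<and> E z y}" using TQ symE that by (auto dest: sympD)
    then have "card T \<le> card {z \<in> T \<union> Q. E x z \<and> E z y}" using fin by (intro card_mono) auto
    then show ?thesis using T that by (simp add: H_def)
  qed
  show "l \<le> card {z \<in> Q. H x z \<and> H z y}" if "x \<in> Q" "y \<in> Q" for x y
  proof -
    have "card (Q - {x, y}) \<le> card {z \<in> Q. H x z \<and> H z y}"
      using fin that by (intro card_mono) (auto intro: Hxy)
    moreover have "card Q - card {x, y} \<le> card (Q - {x, y})" by (rule diff_card_le_card_Diff) simp
    moreover have "card {x, y} \<le> 2" by (simp add: card_insert_if)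
    ultimately show ?thesis using Q by linarith
  qed
  show "Q \<noteq> {}" using Q by auto
qed (use assms in auto)

section \<open>Sets in which all pairs have many common neighbours\<close>

lemma card_nonneighbours_le:
  assumes "finite U" "x \<in> U" "y \<in> U"
    and "card {z \<in> U. \<not> P x z} \<le> d" "card {z \<in> U. \<not> P y z} \<le> d'"
  shows "card U \<le> card {z \<in> U. P x z \<and> P y z} + d + d'"
proof -
  have "U \<subseteq> {z \<in> U. P x z \<and> P y z} \<union> {z \<in> U. \<not> P x z} \<union> {z \<in> U. \<not> P y z}" by blast
  then have "card U \<le> card ({z \<in> U. P x z \<and> P y z} \<union> {z \<in> U. \<not> P x z} \<union> {z \<in> U. \<not> P y z})"
    using assms(1) by (intro card_mono) auto
  also have "\<dots> \<le> card {z \<in> U. P x z \<and> P y z} + card {z \<in> U. \<not> P x z} + card {z \<in> U. \<not> P y z}"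
    by (meson add_le_mono card_Un_le le_refl order_trans)
  finally show ?thesis using assms by linarith
qed

text \<open>If some vertex has many non-neighbours, the independence number drops among them; otherwise
  any two vertices have many common neighbours.\<close>

lemma ex_subset_many_common_neighbours:
  fixes a s m :: nat
  assumes "finite U" and "symp H" and "0 < s"
    and "\<And>I. I \<subseteq> U \<Longrightarrow> (\<forall>x\<in>I. \<forall>y\<in>I. x \<noteq> y \<longrightarrow> \<not> H x y) \<Longrightarrow> card I \<le> a"
    and "2 ^ a * (s + m) \<le> card U + m"
  shows "\<exists>U'\<subseteq>U. s \<le> card U' \<and> (\<forall>x\<in>U'. \<forall>y\<in>U'. m \<le> card {z \<in> U'. H x z \<and> H z y})"
  using assms
proof (induction a arbitrary: U)
  case 0
  then have "0 < card U" by simp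
  then obtain x where "x \<in> U" by (auto simp: card_gt_0_iff)
  then have "card {x} \<le> 0" by (intro 0) auto
  then show ?case by simp
next
  case (Suc a)
  let ?N = "\<lambda>x. {z \<in> U. z \<noteq> x \<and> \<not> H x z}"
  show ?case
  proof (cases "\<exists>x\<in>U. 2 ^ a * (s + m) \<le> card (?N x) + m")
    case True
    then obtain x where x: "x \<in> U" "2 ^ a * (s + m) \<le> card (?N x) + m" by blast
    have "card I \<le> a" if I: "I \<subseteq> ?N x" "\<forall>x\<in>I. \<forall>y\<in>I. x \<noteq> y \<longrightarrow> \<not> H x y" for I
    proof -
      have "card (insert x I) \<le> Suc a"
        using I x Suc.prems(2) by (intro Suc.prems(4)) (auto dest: sympD)
      moreover have "x \<notin> I" "finite I" using I Suc.prems(1) by (auto intro: finite_subset)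
      ultimately show ?thesis by simp
    qed
    moreover have "finite (?N x)" using Suc.prems(1) by simp
    ultimately have "\<exists>U'\<subseteq>?N x. s \<le> card U' \<and>
        (\<forall>x\<in>U'. \<forall>y\<in>U'. m \<le> card {z \<in> U'. H x z \<and> H z y})"
      using Suc.prems(2,3) x(2) by (intro Suc.IH) blast+
    then show ?thesis by blast
  next
    case False
    have small: "card {z \<in> U. \<not> (z \<noteq> x \<and> H x z)} + m \<le> 2 ^ a * (s + m)" if "x \<in> U" for x
    proof -
      have "card {z \<in> U. \<not> (z \<noteq> x \<and> H x z)} \<le> card (insert x (?N x))"
        using Suc.prems(1) by (intro card_mono) auto
      also have "\<dots> \<le> Suc (card (?N x))" by (rule card_insert_le_m1) auto
      finally show ?thesis using False that by fastforce
    qed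
    \<comment> \<open>Together \<open>x\<close> and \<open>y\<close> miss at most
      \<open>2 ^ Suc a * (s + m) - 2 * m\<close> vertices, themselves included, while
      \<open>U\<close> has at least \<open>2 ^ Suc a * (s + m) - m\<close>.\<close>
    have "m \<le> card {z \<in> U. H x z \<and> H z y}" if xy: "x \<in> U" "y \<in> U" for x y
    proof -
      have "card U \<le> card {z \<in> U. (z \<noteq> x \<and> H x z) \<and> (z \<noteq> y \<and> H y z)}
          + card {z \<in> U. \<not> (z \<noteq> x \<and> H x z)} + card {z \<in> U. \<not> (z \<noteq> y \<and> H y z)}"
        using card_nonneighbours_le[OF Suc.prems(1) xy, of "\<lambda>x z. z \<noteq> x \<and> H x z"] by blast
      moreover have "card {z \<in> U. (z \<noteq> x \<and> H x z) \<and> (z \<noteq> y \<and> H y z)}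
          \<le> card {z \<in> U. H x z \<and> H z y}"
        using Suc.prems(1,2) by (intro card_mono) (auto dest: sympD)
      ultimately show ?thesis using small[OF xy(1)] small[OF xy(2)] Suc.prems(5)
        by simp
    qed
    moreover have "s \<le> card U"
    proof -
      have "1 * (s + m) \<le> 2 ^ Suc a * (s + m)" by (intro mult_right_mono) auto
      from order_trans[OF this Suc.prems(5)] show ?thesis by simp
    qed
    ultimately show ?thesis by blast
  qed
qed

text \<open>Each new set meets the union of the earlier ones in at most \<open>card I * d\<close>
  points. The bound serves to show that only few large subsets can be nearly disjoint.\<close>

lemma sum_card_le_card_UN:
  assumes "finite I" "\<And>i. i \<in> I \<Longrightarrow> finite (A i)"
    and "\<And>i j. i \<in> I \<Longrightarrow> j \<in> I \<Longrightarrow> i \<noteq> j \<Longrightarrow> card (A i \<inter> A j) \<le> d"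
  shows "(\<Sum>i\<in>I. card (A i)) \<le> card (\<Union>i\<in>I. A i) + (card I)\<^sup>2 * d"
  using assms
proof (induction I rule: finite_induct)
  case empty
  then show ?case by simp
next
  case (insert x I)
  have IH: "(\<Sum>i\<in>I. card (A i)) \<le> card (\<Union>i\<in>I. A i) + (card I)\<^sup>2 * d"
    by (rule insert.IH) (use insert.prems in blast)+
  have "card (A x \<inter> (\<Union>i\<in>I. A i)) = card (\<Union>i\<in>I. A x \<inter> A i)" by (simp only: Int_UN_distrib)
  also have "\<dots> \<le> (\<Sum>i\<in>I. card (A x \<inter> A i))" using insert(1) by (rule card_UN_le)
  also have "\<dots> \<le> (\<Sum>i\<in>I. d)" using insert by (intro sum_mono) auto
  finally have "card (A x \<inter> (\<Union>i\<in>I. A i)) \<le> card I * d" by simp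
  moreover have "card (A x) + card (\<Union>i\<in>I. A i)
      = card (A x \<union> (\<Union>i\<in>I. A i)) + card (A x \<inter> (\<Union>i\<in>I. A i))"
    using insert by (intro card_Un_Int) auto
  ultimately show ?case using IH insert(1,2)
    by (simp add: power2_eq_square algebra_simps)
qed

section \<open>Gallai partitions\<close>

definition gallai :: "('a set \<Rightarrow> nat) \<Rightarrow> 'a set \<Rightarrow> bool" where
  "gallai c V \<longleftrightarrow> (\<forall>x\<in>V. \<forall>y\<in>V. \<forall>z\<in>V. x \<noteq> y \<longrightarrow> y \<noteq> z \<longrightarrow> x \<noteq> z \<longrightarrow>
     c {x, y} = c {y, z} \<or> c {y, z} = c {x, z} \<or> c {x, y} = c {x, z})"

lemma gallai_subset: "gallai c V \<Longrightarrow> W \<subseteq> V \<Longrightarrow> gallai c W"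
  unfolding gallai_def by blast

text \<open>Distinctness is explicit because \<open>c\<close> also has values on singletons.\<close>

definition adj :: "('a set \<Rightarrow> nat) \<Rightarrow> nat \<Rightarrow> 'a \<Rightarrow> 'a \<Rightarrow> bool" where
  "adj c i x y \<longleftrightarrow> x \<noteq> y \<and> c {x, y} = i"

lemma symp_adj: "symp (adj c i)"
  by (auto simp: symp_def adj_def insert_commute)

section \<open>Components of one colour in a Gallai colouring\<close>

definition reach :: "('a set \<Rightarrow> nat) \<Rightarrow> nat \<Rightarrow> 'a set \<Rightarrow> 'a \<Rightarrow> 'a \<Rightarrow> bool" where
  "reach c i W = (\<lambda>x y. x \<in> W \<and> y \<in> W \<and> adj c i x y)\<^sup>*\<^sup>*"

lemma reach_refl [simp]: "reach c i W x x"
  by (simp add: reach_def)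

lemma reach_adj: "x \<in> W \<Longrightarrow> y \<in> W \<Longrightarrow> adj c i x y \<Longrightarrow> reach c i W x y"
  by (auto simp: reach_def)

lemma reach_trans: "reach c i W x y \<Longrightarrow> reach c i W y z \<Longrightarrow> reach c i W x z"
  by (auto simp: reach_def)

lemma reach_sym: "reach c i W x y \<Longrightarrow> reach c i W y x"
  unfolding reach_def
  by (rule sympD[OF symp_rtranclp]) (auto intro!: sympI intro: sympD[OF symp_adj])

definition color_connected :: "('a set \<Rightarrow> nat) \<Rightarrow> 'a set \<Rightarrow> nat \<Rightarrow> bool" where
  "color_connected c W i \<longleftrightarrow> (\<forall>u\<in>W. \<forall>v\<in>W. reach c i W u v)"

text \<open>For an edge from \<open>v\<close> to \<open>v'\<close> of colour \<open>i\<close> in the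
  component of \<open>u\<close>, neither \<open>{v, w}\<close> nor \<open>{v', w}\<close> has colour
  \<open>i\<close>, as \<open>w\<close> lies outside it. The triangle is not rainbow, so these two
  colours agree; this propagates along the path.\<close>

lemma color_eq_if_reach:
  assumes "gallai c W" "reach c i W u v" "u \<in> W" "w \<in> W" "\<not> reach c i W u w"
  shows "c {u, w} = c {v, w}"
  using assms(2) unfolding reach_def
proof (induction rule: rtranclp_induct)
  case base
  then show ?case by simp
next
  case (step v v')
  have r: "reach c i W u v" using step(1) by (simp add: reach_def)
  have r': "reach c i W u v'" using r step(2) reach_trans reach_adj by metis
  have nr: "\<not> reach c i W v w" "\<not> reach c i W v' w"
    using r r' step(2) assms(4,5) reach_trans reach_sym by metis+
  have "v \<noteq> w" "v' \<noteq> w" using nr by auto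
  then have "c {v, w} \<noteq> i" "c {v', w} \<noteq> i"
    using nr step(2) assms(4) reach_adj by (metis adj_def)+
  moreover have "v \<noteq> v'" "c {v, v'} = i" using step(2) by (auto simp: adj_def)
  ultimately have "c {v, w} = c {v', w}"
    using assms(1,4) step(2) \<open>v \<noteq> w\<close> \<open>v' \<noteq> w\<close> unfolding gallai_def
    by metis
  then show ?case using step by simp
qed

text \<open>Follow the path up to its first visit to \<open>x\<close>, if any; \<open>y\<close> is
  the vertex just before.\<close>

lemma reach_insert_cases:
  assumes "reach c i (insert x W) u v" "u \<in> W" "x \<notin> W"
  shows "(v \<in> W \<and> reach c i W u v) \<or> (\<exists>y\<in>W. reach c i W u y \<and> c {x, y} = i)"
  using assms(1) unfolding reach_def
proof (induction rule: rtranclp_induct)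
  case base
  then show ?case using assms by auto
next
  case (step v v')
  show ?case
  proof (cases "\<exists>y\<in>W. reach c i W u y \<and> c {x, y} = i")
    case False
    then have v: "v \<in> W" "reach c i W u v" using step by (auto simp: reach_def)
    have "v' \<noteq> x" using step(2) False v by (auto simp: adj_def insert_commute)
    then have "reach c i W v v'" "v' \<in> W" using step(2) v by (auto intro: reach_adj)
    then have "v' \<in> W \<and> reach c i W u v'" using v reach_trans by metis
    then show ?thesis by (simp add: reach_def)
  qed (simp add: reach_def)
qed

lemma color_connected_imp_edge:
  assumes "color_connected c (insert x W) j" "x \<notin> W" "W \<noteq> {}"
  shows "\<exists>z\<in>W. c {x, z} = j"
proof -
  obtain w where w: "w \<in> W" using assms by blast
  then have "reach c j (insert x W) x w" using assms by (auto simp: color_connected_def)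
  then show ?thesis unfolding reach_def
    by (cases rule: converse_rtranclpE) (use w assms in \<open>auto simp: adj_def\<close>)
qed

text \<open>Colour \<open>i\<close> falls apart without \<open>x\<close>, so each of its components
  in \<open>W\<close> contains an \<open>i\<close>-neighbour of \<open>x\<close>. Let
  \<open>z\<close> and \<open>z'\<close> be neighbours of \<open>x\<close> in colours
  \<open>j\<close> and \<open>l\<close>. Triangles through \<open>x\<close> force colour
  \<open>j\<close> from \<open>z\<close> to the \<open>i\<close>-neighbours of \<open>x\<close> in
  other components, and \<open>l\<close> from \<open>z'\<close>. But all edges between two
  components have the same colour.\<close>

lemma not_three_connected_step:
  assumes g: "gallai c (insert x W)" and x: "x \<notin> W"
    and conn: "color_connected c (insert x W) i" "color_connected c (insert x W) j"
      "color_connected c (insert x W) l"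
    and dist: "i \<noteq> j" "i \<noteq> l" "j \<noteq> l" and nc: "\<not> color_connected c W i"
  shows False
proof -
  have gW: "gallai c W" using g gallai_subset by blast
  obtain u v where uv: "u \<in> W" "v \<in> W" "\<not> reach c i W u v"
    using nc by (auto simp: color_connected_def)
  have near: "\<exists>y\<in>W. reach c i W w y \<and> c {x, y} = i" if "w \<in> W" for w
    using reach_insert_cases[of c i x W w x] conn(1) that x by (auto simp: color_connected_def)
  have color: "c {z, y} = c {x, z}"
    if "z \<in> W" "y \<in> W" "\<not> reach c i W z y" "c {x, y} = i" "c {x, z} \<noteq> i" for z y
  proof -
    have "z \<noteq> y" using that by auto
    then have "c {z, y} \<noteq> i" using that reach_adj by (metis adj_def)
    moreover have "x \<noteq> z" "x \<noteq> y" using that x by auto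
    ultimately show ?thesis using g that \<open>z \<noteq> y\<close> unfolding gallai_def by (metis insertCI)
  qed
  obtain z z' where z: "z \<in> W" "c {x, z} = j" "z' \<in> W" "c {x, z'} = l"
    using color_connected_imp_edge conn x uv by (metis empty_iff)
  show False
  proof (cases "reach c i W z z'")
    case False
    obtain y where y: "y \<in> W" "reach c i W z y" "c {x, y} = i" using near z by blast
    obtain y' where y': "y' \<in> W" "reach c i W z' y'" "c {x, y'} = i" using near z by blast
    have n: "\<not> reach c i W z' z" using False reach_sym by metis
    have "\<not> reach c i W z y'" "\<not> reach c i W z' y"
      using False y y' reach_trans reach_sym by metis+
    then have "c {z, y'} = j" "c {z', y} = l"
      using color[of z y'] color[of z' y] z y y' dist by auto
    moreover have "c {z', z} = c {y', z}" "c {z, z'} = c {y, z'}"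
      using color_eq_if_reach[OF gW y'(2) z(3,1) n] color_eq_if_reach[OF gW y(2) z(1,3) False]
      by auto
    ultimately show False using dist by (simp add: insert_commute)
  next
    case True
    obtain w where w: "w \<in> W" "\<not> reach c i W z w"
      using uv reach_trans reach_sym by metis
    obtain y where y: "y \<in> W" "reach c i W w y" "c {x, y} = i" using near w by blast
    have n: "\<not> reach c i W z y" using w y reach_trans reach_sym by metis
    then have "\<not> reach c i W z' y" using True reach_trans by metis
    then have "c {z, y} = j" "c {z', y} = l"
      using color[of z y] color[of z' y] z y n dist by auto
    moreover have "c {z, y} = c {z', y}"
      using color_eq_if_reach[OF gW True z(1) y(1) n] .
    ultimately show False using dist by simp
  qed
qed

text \<open>Otherwise remove a vertex: by induction one of the three colours becomes disconnected,
  which the preceding lemma excludes. Two vertices carry only one colour.\<close>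

lemma not_three_connected:
  assumes "finite W" "2 \<le> card W" "gallai c W" and dist: "i \<noteq> j" "i \<noteq> l" "j \<noteq> l"
  shows "\<not> (color_connected c W i \<and> color_connected c W j \<and> color_connected c W l)"
  using assms(1-3)
proof (induction W rule: finite_induct)
  case empty
  then show ?case by simp
next
  case (insert x W)
  have gW: "gallai c W" using insert(5) gallai_subset by blast
  show ?case
  proof (cases "card W = 1")
    case True
    then obtain w where [simp]: "W = {w}" by (auto simp: card_1_singleton_iff)
    show ?thesis
      using color_connected_imp_edge[of c x W] insert(2) dist
      by (metis singletonD \<open>W = {w}\<close> insert_not_empty)
  next
    case False
    then have "2 \<le> card W" using insert by simp
    then have "\<not> color_connected c W i \<or> \<not> color_connected c W j \<or> \<not> color_connected c W l"
      using insert.IH gW by blast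
    then show ?thesis
      using not_three_connected_step[OF insert(5,2)] dist by metis
  qed
qed

text \<open>The partition is given by a choice \<open>r\<close> of a representative for each part.\<close>

lemma gallai_partition:
  assumes "finite V" "2 \<le> card V" "gallai c V"
    and "\<And>x y. x \<in> V \<Longrightarrow> y \<in> V \<Longrightarrow> x \<noteq> y \<Longrightarrow> c {x, y} < k" and "2 \<le> k"
  shows "\<exists>r a b. r ` V \<subseteq> V \<and> 2 \<le> card (r ` V) \<and> a < k \<and> b < k \<and> a \<noteq> b \<and>
    (\<forall>x\<in>V. \<forall>y\<in>V. r x \<noteq> r y \<longrightarrow> c {x, y} = c {r x, r y} \<and> c {x, y} \<in> {a, b})"
  using assms
proof (induction "card V" arbitrary: V rule: less_induct)
  case less
  define C where "C = {c {x, y} | x y. x \<in> V \<and> y \<in> V \<and> x \<noteq> y}"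
  have Ck: "C \<subseteq> {..<k}" using less.prems(4) by (auto simp: C_def)
  then have finC: "finite C" using finite_subset by blast
  show ?case
  proof (cases "card C \<le> 2")
    case True
    \<comment> \<open>Every vertex is a part of its own; the occurring colours are padded to exactly
      two.\<close>
    then obtain C' where C': "C \<subseteq> C'" "C' \<subseteq> {..<k}" "card C' = 2"
      using exists_subset_between[of C 2 "{..<k}"] Ck less.prems(5) by auto
    then obtain a b where "C' = {a, b}" "a \<noteq> b" by (auto simp: card_2_iff)
    then have ab: "a < k" "b < k" "a \<noteq> b" "\<forall>x\<in>V. \<forall>y\<in>V. x \<noteq> y \<longrightarrow> c {x, y} \<in> {a, b}"
      using C' by (auto simp: C_def)
    show ?thesis
      by (rule exI[of _ "\<lambda>x. x"], rule exI[of _ a], rule exI[of _ b]) (use ab less.prems in simp)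
  next
    case False
    then have "3 \<le> card C" by simp
    then obtain C3 where "C3 \<subseteq> C" "card C3 = 3" by (meson obtain_subset_with_card_n)
    then obtain i j l where ijl: "i \<in> C" "j \<in> C" "l \<in> C" "i \<noteq> j" "j \<noteq> l" "i \<noteq> l"
      by (auto simp: card_3_iff)
    \<comment> \<open>The components of \<open>h\<close> are contracted. At least two remain since
      \<open>h\<close> is disconnected, and fewer than \<open>card V\<close> since \<open>h\<close>
      occurs.\<close>
    then obtain h where h: "h \<in> C" "\<not> color_connected c V h"
      using not_three_connected[OF less.prems(1-3)] by metis
    define s where "s = (\<lambda>x. SOME y. y \<in> V \<and> reach c h V x y)"
    have s: "s x \<in> V \<and> reach c h V x (s x)" if "x \<in> V" for x
      unfolding s_def by (rule someI[of _ x]) (use that in auto)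
    have s_eq: "s x = s y" if "reach c h V x y" for x y
    proof -
      have "reach c h V x z \<longleftrightarrow> reach c h V y z" for z
        using that reach_trans reach_sym by metis
      then show ?thesis by (simp add: s_def)
    qed
    have ss: "s (s x) = s x" if "x \<in> V" for x using s s_eq that by metis
    obtain u v where uv: "u \<in> V" "v \<in> V" "\<not> reach c h V u v"
      using h by (auto simp: color_connected_def)
    have "s u \<noteq> s v" using s uv reach_trans reach_sym by metis
    moreover have "{s u, s v} \<subseteq> s ` V" using uv by auto
    ultimately have card2: "2 \<le> card (s ` V)"
      using less.prems(1) card_mono[of "s ` V" "{s u, s v}"] by simp
    obtain p q where pq: "p \<in> V" "q \<in> V" "p \<noteq> q" "c {p, q} = h"
      using h(1) by (auto simp: C_def)
    then have "s p = s q" by (intro s_eq reach_adj) (auto simp: adj_def)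
    then have "\<not> inj_on s V" using pq by (auto simp: inj_on_def)
    then have smaller: "card (s ` V) < card V"
      using less.prems(1) by (metis card_image_le eq_card_imp_inj_on le_neq_implies_less)
    have sV: "s ` V \<subseteq> V" using s by auto
    have cs: "c {x, y} = c {s x, s y}" if xy: "x \<in> V" "y \<in> V" "s x \<noteq> s y" for x y
    proof -
      have "\<not> reach c h V x y" using xy s_eq by metis
      then have 1: "c {x, y} = c {s x, y}"
        using color_eq_if_reach less.prems(3) s xy by metis
      have "\<not> reach c h V y (s x)" using xy s_eq ss by metis
      then have "c {y, s x} = c {s y, s x}"
        using color_eq_if_reach less.prems(3) s xy by metis
      then show ?thesis using 1 by (simp add: insert_commute)
    qed
    have "\<exists>r a b. r ` s ` V \<subseteq> s ` V \<and> 2 \<le> card (r ` s ` V) \<and> a < k \<and> b < k \<and> a \<noteq> b \<and>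
      (\<forall>x\<in>s ` V. \<forall>y\<in>s ` V. r x \<noteq> r y \<longrightarrow> c {x, y} = c {r x, r y} \<and> c {x, y} \<in> {a, b})"
    proof (rule less.hyps[OF smaller])
      show "gallai c (s ` V)" using gallai_subset less.prems(3) sV by blast
      show "c {x, y} < k" if "x \<in> s ` V" "y \<in> s ` V" "x \<noteq> y" for x y
        using that sV less.prems(4) by blast
    qed (use less.prems card2 in auto)
    then obtain r a b where r: "r ` s ` V \<subseteq> s ` V" "2 \<le> card (r ` s ` V)" "a < k" "b < k" "a \<noteq> b"
      "\<forall>x\<in>s ` V. \<forall>y\<in>s ` V. r x \<noteq> r y \<longrightarrow> c {x, y} = c {r x, r y} \<and> c {x, y} \<in> {a, b}"
      by (elim exE conjE) (rule that)
    have rs: "c {x, y} = c {r (s x), r (s y)} \<and> c {x, y} \<in> {a, b}"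
      if "x \<in> V" "y \<in> V" "r (s x) \<noteq> r (s y)" for x y
    proof -
      have "s x \<noteq> s y" using that by auto
      then show ?thesis using cs[OF that(1,2)] r(6)[rule_format, of "s x" "s y"] that by auto
    qed
    have rsV: "(r \<circ> s) ` V \<subseteq> V" "2 \<le> card ((r \<circ> s) ` V)"
      using order_trans[OF r(1) sV] r(2) by (simp_all add: image_comp)
    show ?thesis
      by (rule exI[of _ "r \<circ> s"], rule exI[of _ a], rule exI[of _ b])
        (use rs rsV r(3-5) in \<open>simp only: comp_apply, blast\<close>)
  qed
qed

text \<open>The vertex \<open>v\<close> itself is counted, so \<open>l\<close> bounds everything
  that is neither an \<open>a\<close>- nor a \<open>b\<close>-neighbour of \<open>v\<close>.\<close>

definition nearly_two_colored :: "('a set \<Rightarrow> nat) \<Rightarrow> nat \<Rightarrow> nat \<Rightarrow> nat \<Rightarrow> 'a set \<Rightarrow> bool" where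
  "nearly_two_colored c a b l X \<longleftrightarrow> (\<forall>v\<in>X. card {u \<in> X. u = v \<or> c {u, v} \<notin> {a, b}} \<le> l)"

text \<open>Vertices joined monochromatically to the rest are discarded until more than \<open>k * l\<close> of them
  have accumulated (some colour then occurs \<open>l\<close> times) or no part of size at least a third
  of the remaining set is left to descend to.\<close>

lemma biclique_or_two_colors:
  assumes fin: "finite S" and g: "gallai c S"
    and col: "\<forall>x\<in>S. \<forall>y\<in>S. x \<noteq> y \<longrightarrow> c {x, y} < k"
    and k: "2 \<le> k" and S: "k * l + 2 \<le> card S"
  shows "(\<exists>S' T i. S' \<subseteq> S \<and> T \<subseteq> S \<and> S' \<inter> T = {} \<and> l \<le> card T \<and> i < k \<and>
        (\<forall>x\<in>S'. \<forall>y\<in>T. c {x, y} = i) \<and> card S \<le> 3 * card S' + k * l) \<or>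
    (\<exists>S' a b. S' \<subseteq> S \<and> a < k \<and> b < k \<and> a \<noteq> b \<and> card S \<le> card S' + k * l \<and>
        nearly_two_colored c a b l S')"
    (is "?biclique \<or> ?sparse")
proof (rule disjCI)
  assume nsparse: "\<not> ?sparse"
  \<comment> \<open>A good set is what remains after discarding at most \<open>k * l\<close>
    vertices, each joined to it in a single colour. A smallest one is taken.\<close>
  define good where "good S' \<longleftrightarrow> S' \<subseteq> S \<and> (\<forall>x\<in>S - S'. \<exists>i. \<forall>y\<in>S'. c {x, y} = i) \<and>
    card (S - S') \<le> k * l" for S'
  have "good S" by (simp add: good_def)
  then obtain S' where S': "good S'" "\<And>A. good A \<Longrightarrow> card S' \<le> card A"
    using ex_has_least_nat[of good S card] by blast
  have sub: "S' \<subseteq> S" and finS': "finite S'"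
    using S'(1) fin by (auto simp: good_def intro: finite_subset)
  have cardS: "card S \<le> card S' + k * l"
    using S'(1) card_Diff_subset[OF finS' sub] unfolding good_def by linarith
  have "gallai c S'" using g gallai_subset sub by blast
  moreover have "2 \<le> card S'" using cardS S by linarith
  moreover have "c {x, y} < k" if "x \<in> S'" "y \<in> S'" "x \<noteq> y" for x y using that sub col by blast
  ultimately have "\<exists>r a b. r ` S' \<subseteq> S' \<and> 2 \<le> card (r ` S') \<and> a < k \<and> b < k \<and> a \<noteq> b \<and>
      (\<forall>x\<in>S'. \<forall>y\<in>S'. r x \<noteq> r y \<longrightarrow> c {x, y} = c {r x, r y} \<and> c {x, y} \<in> {a, b})"
    using finS' k by (intro gallai_partition)
  then obtain r a b where r: "2 \<le> card (r ` S')" "a < k" "b < k" "a \<noteq> b"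
    and rc: "\<forall>x\<in>S'. \<forall>y\<in>S'. r x \<noteq> r y \<longrightarrow> c {x, y} = c {r x, r y} \<and> c {x, y} \<in> {a, b}"
    by (elim exE conjE) (rule that)
  obtain v where v: "v \<in> S'" "l < card {u \<in> S'. u = v \<or> c {u, v} \<notin> {a, b}}"
    using nsparse sub cardS r(2-4) unfolding nearly_two_colored_def by (meson not_le)
  define A where "A = {u \<in> S'. r u = r v}"
  have A: "A \<subseteq> S'" "finite A" "v \<in> A" using finS' v by (auto simp: A_def)
  have "{u \<in> S'. u = v \<or> c {u, v} \<notin> {a, b}} \<subseteq> A" using rc v by (auto simp: A_def)
  then have lA: "l < card A" using v(2) card_mono[OF A(2)] by (meson le_less_trans not_le)
  have between: "c {x, y} = c {r x, r v} \<and> c {x, y} \<in> {a, b}" if "x \<in> S' - A" "y \<in> A" for x y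
    using rc[rule_format, of x y] that by (auto simp: A_def)
  show ?biclique
  proof (cases "card S' \<le> 3 * card A")
    case True
    have hom: "\<exists>i. \<forall>y\<in>A. c {x, y} = i" if "x \<in> S - A" for x
    proof (cases "x \<in> S'")
      case True
      then show ?thesis using between that by blast
    next
      case False
      then show ?thesis using S'(1) A(1) that unfolding good_def by blast
    qed
    have "A \<noteq> S'"
    proof
      assume "A = S'"
      then have "r ` S' \<subseteq> {r v}" by (auto simp: A_def)
      then have "card (r ` S') \<le> card {r v}" by (intro card_mono) auto
      then show False using r(1) by simp
    qed
    \<comment> \<open>By minimality \<open>A\<close> can only fail to be good because more than
      \<open>k * l\<close> vertices lie outside; by pigeonhole more than \<open>l\<close> of them
      are joined to \<open>A\<close> in one colour.\<close>
    then have "card A < card S'" using A finS' by (simp add: psubset_card_mono psubsetI)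
    then have "\<not> good A" using S'(2) by (meson not_le)
    then have big: "k * l < card (S - A)" using hom A sub by (auto simp: good_def)
    define T where "T i = {x \<in> S - A. \<forall>y\<in>A. c {x, y} = i}" for i
    have "S - A \<subseteq> (\<Union>i\<in>{..<k}. T i)"
    proof
      fix x assume x: "x \<in> S - A"
      then obtain i where i: "\<forall>y\<in>A. c {x, y} = i" using hom by blast
      then have "i < k" using col[rule_format, of x v] x A sub by auto
      then show "x \<in> (\<Union>i\<in>{..<k}. T i)" using x i by (auto simp: T_def)
    qed
    then have "card (S - A) \<le> card (\<Union>i\<in>{..<k}. T i)"
      using fin by (intro card_mono) (auto simp: T_def)
    also have "\<dots> \<le> (\<Sum>i<k. card (T i))" by (rule card_UN_le) simp
    finally have "k * l < (\<Sum>i<k. card (T i))" using big by simp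
    then obtain i where i: "i < k" "l < card (T i)"
      using sum_bounded_above[of "{..<k}" "\<lambda>i. card (T i)" l] by force
    have T: "\<forall>x\<in>A. \<forall>y\<in>T i. c {x, y} = i" by (auto simp: T_def insert_commute)
    have T': "A \<inter> T i = {}" "T i \<subseteq> S" by (auto simp: T_def)
    show ?thesis
      by (rule exI[of _ A], rule exI[of _ "T i"], rule exI[of _ i])
        (use T T' i A sub cardS True in auto)
  next
    case False
    \<comment> \<open>Over two thirds of \<open>S'\<close> lie outside \<open>A\<close>, split by
      their colour towards it into two classes. The larger class is the set to descend to, and
      \<open>A\<close> is joined to it.\<close>
    define R where "R i = {x \<in> S' - A. c {r x, r v} = i}" for i
    have "S' - A \<subseteq> R a \<union> R b" using between A(3) by (fastforce simp: R_def)
    then have "card (S' - A) \<le> card (R a \<union> R b)" using finS' by (intro card_mono) (auto simp: R_def)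
    also have "\<dots> \<le> card (R a) + card (R b)" by (rule card_Un_le)
    finally have "card S' - card A \<le> card (R a) + card (R b)"
      using A card_Diff_subset by metis
    then have "card S' \<le> 3 * card (R a) \<or> card S' \<le> 3 * card (R b)" using False by linarith
    then obtain i where i: "i < k" "card S' \<le> 3 * card (R i)" using r by blast
    have R: "\<forall>x\<in>R i. \<forall>y\<in>A. c {x, y} = i" using between by (auto simp: R_def)
    have R': "R i \<inter> A = {}" "R i \<subseteq> S" using sub by (auto simp: R_def)
    show ?thesis
      by (rule exI[of _ "R i"], rule exI[of _ A], rule exI[of _ i])
        (use R R' i A sub cardS lA in auto)
  qed
qed

section \<open>Monochromatic wheels\<close>

text \<open>Here \<open>l\<close> is the length of the rim, so the wheel has order
  \<open>l + 1\<close>.\<close>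

definition mono_wheel :: "('a set \<Rightarrow> nat) \<Rightarrow> 'a set \<Rightarrow> nat \<Rightarrow> bool" where
  "mono_wheel c V l \<longleftrightarrow> (\<exists>i. \<exists>h\<in>V. has_cycle (adj c i) {x \<in> V. adj c i h x} l)"

lemma mono_wheelI:
  assumes "h \<in> V" "has_cycle (adj c i) S l" "S \<subseteq> V" "\<And>x. x \<in> S \<Longrightarrow> adj c i h x"
  shows "mono_wheel c V l"
  using assms has_cycle_mono[of "adj c i" S l "{x \<in> V. adj c i h x}"]
  unfolding mono_wheel_def by blast

text \<open>The hub misses at most \<open>d\<close> vertices and any two of its neighbours at most
  \<open>2 * d\<close> more, which leaves them \<open>l\<close> common neighbours. An edge is
  lengthened with fixed ends to a path on \<open>l\<close> vertices, which the edge itself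
  closes.\<close>

lemma mono_wheel_of_dense:
  fixes l :: nat
  assumes fin: "finite U" and UV: "U \<subseteq> V" and l: "2 \<le> l"
    and nonadj: "\<And>x. x \<in> U \<Longrightarrow> card {u \<in> U. \<not> adj c i x u} \<le> d"
    and card: "3 * d + l \<le> card U"
  shows "mono_wheel c V l"
proof -
  obtain h where h: "h \<in> U" using card l by fastforce
  define W where "W = {x \<in> U. adj c i h x}"
  have finW: "finite W" using fin by (simp add: W_def)
  have W: "2 * d + l \<le> card W"
  proof -
    have "card U \<le> card (W \<union> {u \<in> U. \<not> adj c i h u})"
      using fin by (intro card_mono) (auto simp: W_def)
    also have "\<dots> \<le> card W + card {u \<in> U. \<not> adj c i h u}" by (rule card_Un_le)
    finally show ?thesis using nonadj[OF h] card by linarith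
  qed
  have common: "l \<le> card {z \<in> W. adj c i x z \<and> adj c i z y}" if xy: "x \<in> W" "y \<in> W" for x y
  proof -
    have "card {z \<in> W. \<not> adj c i x z} \<le> d" if "x \<in> W" for x
    proof -
      have "card {z \<in> W. \<not> adj c i x z} \<le> card {z \<in> U. \<not> adj c i x z}"
        using fin by (intro card_mono) (auto simp: W_def)
      then show ?thesis using nonadj[of x] that by (auto simp: W_def)
    qed
    then have "card W \<le> card {z \<in> W. adj c i x z \<and> adj c i y z} + d + d"
      using card_nonneighbours_le[OF finW xy] xy by blast
    moreover have "adj c i y z \<longleftrightarrow> adj c i z y" for z by (auto simp: adj_def insert_commute)
    ultimately show ?thesis using W by simp
  qed
  obtain x where x: "x \<in> W" using W l by fastforce
  have "0 < card {z \<in> W. adj c i x z \<and> adj c i z x}" using common[OF x x] l by linarith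
  then obtain y where y: "y \<in> W" "adj c i x y" "adj c i y x" by (auto simp: card_gt_0_iff)
  have "x \<noteq> y" using y by (simp add: adj_def)
  then have "\<exists>ys. successively (adj c i) ys \<and> distinct ys \<and> set ys \<subseteq> W \<and> length ys = l \<and>
      hd ys = hd [x, y] \<and> last ys = last [x, y]"
    using x y l by (intro path_extend[OF common]) auto
  then have "has_cycle (adj c i) W l" using y by (auto simp: has_cycle_def)
  then show ?thesis using h UV by (intro mono_wheelI[of h V c i W]) (auto simp: W_def)
qed

section \<open>Wheels in nearly two-coloured sets\<close>

lemma nearly_two_colored_commute:
  "nearly_two_colored c a b l X \<longleftrightarrow> nearly_two_colored c b a l X"
  by (simp add: nearly_two_colored_def insert_commute)

lemma nearly_two_colored_subset:
  assumes "nearly_two_colored c a b l X" "Y \<subseteq> X" "finite X"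
  shows "nearly_two_colored c a b l Y"
  unfolding nearly_two_colored_def
proof
  fix v assume "v \<in> Y"
  have "card {u \<in> Y. u = v \<or> c {u, v} \<notin> {a, b}} \<le> card {u \<in> X. u = v \<or> c {u, v} \<notin> {a, b}}"
    using assms by (intro card_mono) auto
  then show "card {u \<in> Y. u = v \<or> c {u, v} \<notin> {a, b}} \<le> l"
    using assms \<open>v \<in> Y\<close> unfolding nearly_two_colored_def by (meson order_trans subsetD)
qed

lemma card_nonadj_le:
  assumes "nearly_two_colored c a b l X" "finite X" "v \<in> X"
  shows "card {u \<in> X. \<not> adj c b v u} \<le> l + card {u \<in> X. adj c a v u}"
proof -
  have "card {u \<in> X. \<not> adj c b v u}
      \<le> card ({u \<in> X. u = v \<or> c {u, v} \<notin> {a, b}} \<union> {u \<in> X. adj c a v u})"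
    using assms(2) by (intro card_mono) (auto simp: adj_def insert_commute)
  also have "\<dots> \<le> card {u \<in> X. u = v \<or> c {u, v} \<notin> {a, b}} + card {u \<in> X. adj c a v u}"
    by (rule card_Un_le)
  finally show ?thesis using assms by (fastforce simp: nearly_two_colored_def)
qed

lemma mono_wheel_of_absent_color:
  fixes l :: nat
  assumes "finite X" "X \<subseteq> V" "2 \<le> l" "nearly_two_colored c a b l X" "4 * l \<le> card X"
    and "\<And>x y. x \<in> X \<Longrightarrow> y \<in> X \<Longrightarrow> \<not> adj c a x y"
  shows "mono_wheel c V l"
proof (rule mono_wheel_of_dense[where U = X and d = l and i = b])
  show "card {u \<in> X. \<not> adj c b x u} \<le> l" if "x \<in> X" for x
  proof -
    have "card {u \<in> X. adj c a x u} = 0" using assms(6) that by (simp add: card_eq_0_iff)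
    then show ?thesis using card_nonadj_le[OF assms(4,1) that] by linarith
  qed
qed (use assms in auto)

text \<open>A vertex with many \<open>a\<close>-neighbours \<open>Q\<close> is a hub for cycles
  through \<open>T\<close> and \<open>Q\<close>, of either parity once \<open>Q\<close> contains an
  \<open>a\<close>-edge; otherwise \<open>Q\<close> is nearly all \<open>b\<close>. If all
  \<open>a\<close>-degrees are below \<open>4 * l\<close>, colour \<open>b\<close> is dense with
  \<open>d = 5 * l\<close>, whence \<open>16 * l\<close>.\<close>

lemma mono_wheel_of_joined_set:
  fixes l :: nat
  assumes fin: "finite V" and XV: "X \<subseteq> V" and l: "5 \<le> l" and near: "nearly_two_colored c a b l X"
    and X: "16 * l \<le> card X" and T: "T \<subseteq> V" "T \<inter> X = {}" "l \<le> card T"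
    and TX: "\<And>x y. x \<in> X \<Longrightarrow> y \<in> T \<Longrightarrow> c {x, y} = a"
  shows "mono_wheel c V l"
proof (cases "\<exists>v\<in>X. 4 * l \<le> card {x \<in> X. adj c a v x}")
  case True
  then obtain v where v: "v \<in> X" "4 * l \<le> card {x \<in> X. adj c a v x}" by blast
  define Q where "Q = {x \<in> X. adj c a v x}"
  have finX: "finite X" using XV fin finite_subset by blast
  have TX': "adj c a y x" "adj c a x y" if "x \<in> X" "y \<in> T" for x y
    using that TX T by (auto simp: adj_def insert_commute)
  show ?thesis
  proof (cases "\<exists>x\<in>Q. \<exists>y\<in>Q. x \<noteq> y \<and> adj c a x y")
    case True
    have "has_cycle (adj c a) (T \<union> Q) l"
    proof (rule has_cycle_bipartite)
      show "l + 2 \<le> card Q" using v l by (simp add: Q_def)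
    qed (use True T l fin finX TX' symp_adj finite_subset in \<open>auto simp: Q_def\<close>)
    then show ?thesis
      using v XV T TX' by (intro mono_wheelI[of v V c a "T \<union> Q"]) (auto simp: Q_def)
  next
    case False
    have "Q \<subseteq> X" by (auto simp: Q_def)
    note near_Q = nearly_two_colored_subset[OF near this finX]
    show ?thesis
    proof (rule mono_wheel_of_absent_color[OF _ _ _ near_Q])
      show "\<not> adj c a x y" if "x \<in> Q" "y \<in> Q" for x y
        using False that by (auto simp: adj_def)
    qed (use v finX XV l in \<open>auto simp: Q_def\<close>)
  qed
next
  case False
  have finX: "finite X" using XV fin finite_subset by blast
  show ?thesis
  proof (rule mono_wheel_of_dense[where U = X and d = "5 * l" and i = b])
    show "card {u \<in> X. \<not> adj c b x u} \<le> 5 * l" if "x \<in> X" for x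
      using card_nonadj_le[OF near finX that] False that by fastforce
  qed (use X XV l finX in auto)
qed

text \<open>Rich vertices see at least a quarter of the neighbourhood \<open>S\<close> of the hub in
  colour \<open>a\<close>. The constant is \<open>332 = 4 * (79 + 4)\<close>: with fewer than
  \<open>79 * l\<close> rich vertices, the others are numerous enough for a wheel in the then dense
  colour \<open>b\<close>.\<close>

lemma mono_wheel_of_large_degree:
  fixes l :: nat
  assumes fin: "finite X" and XV: "X \<subseteq> V" and l: "5 \<le> l" and near: "nearly_two_colored c a b l X"
    and v: "v \<in> X" and deg: "332 * l \<le> card {x \<in> X. adj c a v x}"
  shows "mono_wheel c V l"
proof -
  define S where "S = {x \<in> X. adj c a v x}"
  define N where "N x = {z \<in> S. adj c a x z}" for x
  define rich where "rich = {x \<in> S. card S \<le> 4 * card (N x)}"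
  have S: "S \<subseteq> V" "S \<subseteq> X" "finite S" "332 * l \<le> card S"
    using deg fin XV by (auto simp: S_def)
  have hub: "adj c a v x" if "x \<in> S" for x using that by (simp add: S_def)
  show ?thesis
  proof (cases "79 * l \<le> card rich")
    case True
    have rich: "rich \<subseteq> S" "finite rich" using S by (auto simp: rich_def)
    define H where "H = (\<lambda>x y. x \<noteq> y \<and> l \<le> card {z \<in> S. adj c a x z \<and> adj c a z y})"
    have H: "H x y \<longleftrightarrow> x \<noteq> y \<and> l \<le> card (N x \<inter> N y)" for x y
    proof -
      have "{z \<in> S. adj c a x z \<and> adj c a z y} = N x \<inter> N y"
        by (auto simp: N_def adj_def insert_commute)
      then show ?thesis by (simp add: H_def)
    qed
    have symH: "symp H" by (auto simp: symp_def H Int_commute)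
    have indep: "card I \<le> 4" if I: "I \<subseteq> rich" "\<forall>x\<in>I. \<forall>y\<in>I. x \<noteq> y \<longrightarrow> \<not> H x y" for I
    proof (rule ccontr)
      assume "\<not> card I \<le> 4"
      then have "5 \<le> card I" by simp
      then obtain J where J: "J \<subseteq> I" "card J = 5" "finite J"
        by (rule obtain_subset_with_card_n)
      \<comment> \<open>Five quarters of \<open>S\<close> with pairwise intersections of size at
        most \<open>l\<close> do not fit into \<open>S\<close>: this would force
        \<open>card S \<le> 100 * l\<close>.\<close>
      have "(\<Sum>x\<in>J. card (N x)) \<le> card (\<Union>x\<in>J. N x) + (card J)\<^sup>2 * l"
      proof (rule sum_card_le_card_UN[OF J(3)])
        show "card (N x \<inter> N y) \<le> l" if "x \<in> J" "y \<in> J" "x \<noteq> y" for x y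
          using I(2) J(1) that H by (meson nle_le subsetD)
      qed (use S in \<open>auto simp: N_def\<close>)
      moreover have "card (\<Union>x\<in>J. N x) \<le> card S"
        using S by (intro card_mono) (auto simp: N_def)
      moreover have "(\<Sum>x\<in>J. card S) \<le> (\<Sum>x\<in>J. 4 * card (N x))"
        using J I by (intro sum_mono) (auto simp: rich_def)
      ultimately show False using S(4) l J by (simp flip: sum_distrib_left)
    qed
    \<comment> \<open>With independence bound 4 and \<open>s = 4 * l\<close>, \<open>m = l\<close>,
      the requirement reads \<open>2 ^ 4 * (5 * l) \<le> card rich + l\<close>, hence
      \<open>79 * l\<close>.\<close>
    have "\<exists>U\<subseteq>rich. 4 * l \<le> card U \<and> (\<forall>x\<in>U. \<forall>y\<in>U. l \<le> card {z \<in> U. H x z \<and> H z y})"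
      using ex_subset_many_common_neighbours[OF rich(2) symH _ indep, of "4 * l" l] True l by simp
    then obtain U where U: "U \<subseteq> rich" "4 * l \<le> card U"
      "\<And>x y. x \<in> U \<Longrightarrow> y \<in> U \<Longrightarrow> l \<le> card {z \<in> U. H x z \<and> H z y}" by blast
    show ?thesis
    proof (cases "odd l \<and> \<not> (\<exists>x\<in>U. \<exists>y\<in>U. x \<noteq> y \<and> adj c a x y)")
      case True
      have UX: "U \<subseteq> X" using U rich S by blast
      show ?thesis
      proof (rule mono_wheel_of_absent_color[OF _ _ _ nearly_two_colored_subset[OF near UX fin]])
        show "finite U" using UX fin by (rule finite_subset)
        show "\<not> adj c a x y" if "x \<in> U" "y \<in> U" for x y
          using True that by (auto simp: adj_def)
      qed (use U UX XV l in auto)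
    next
      case False
      have "has_cycle (adj c a) S l"
      proof (rule has_cycle_of_common_neighbours[where H = H and U = U])
        show "U \<noteq> {}" using U(2) l by auto
      qed (use U rich S l False symp_adj in \<open>auto simp: H_def\<close>)
      then show ?thesis using v XV S hub by (intro mono_wheelI[of v V c a S]) auto
    qed
  next
    case False
    have nonadj: "card {u \<in> S - rich. \<not> adj c b x u} \<le> l + card S div 4" if x: "x \<in> S - rich" for x
    proof -
      have "card {u \<in> S - rich. \<not> adj c b x u} \<le> card {u \<in> S. \<not> adj c b x u}"
        using S by (intro card_mono) auto
      also have "\<dots> \<le> l + card (N x)"
        using card_nonadj_le[OF nearly_two_colored_subset[OF near S(2) fin] S(3)] x
        by (simp add: N_def)
      also have "card (N x) \<le> card S div 4" using x by (auto simp: rich_def)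
      finally show ?thesis by simp
    qed
    define q where "q = card S div 4"
    define poor where "poor = S - rich"
    have "4 * q \<le> card S" by (simp add: q_def)
    moreover have "card S \<le> card rich + card poor"
    proof -
      have "rich \<union> poor = S" by (auto simp: rich_def poor_def)
      then show ?thesis using card_Un_le[of rich poor] by simp
    qed
    ultimately have "3 * (l + q) + l \<le> card poor"
      using False S(4) by simp
    then show ?thesis
      using S l nonadj by (intro mono_wheel_of_dense[of poor V l c b "l + q"]) (auto simp: q_def poor_def)
  qed
qed

text \<open>As \<open>665 = 2 * 332 + 1\<close> and a vertex loses at most \<open>l\<close> vertices
  to other colours, itself included, its degree in \<open>a\<close> or in \<open>b\<close> is at
  least \<open>332 * l\<close>.\<close>

lemma mono_wheel_of_two_colors:
  fixes l :: nat
  assumes fin: "finite X" and XV: "X \<subseteq> V" and l: "5 \<le> l" and near: "nearly_two_colored c a b l X"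
    and X: "665 * l \<le> card X"
  shows "mono_wheel c V l"
proof -
  obtain v where v: "v \<in> X" using X l by fastforce
  have "card X \<le> card ({u \<in> X. \<not> adj c b v u} \<union> {u \<in> X. adj c b v u})"
    using fin by (intro card_mono) auto
  also have "\<dots> \<le> card {u \<in> X. \<not> adj c b v u} + card {u \<in> X. adj c b v u}"
    by (rule card_Un_le)
  also have "\<dots> \<le> l + card {u \<in> X. adj c a v u} + card {u \<in> X. adj c b v u}"
    using card_nonadj_le[OF near fin v] by simp
  finally have "332 * l \<le> card {u \<in> X. adj c a v u} \<or> 332 * l \<le> card {u \<in> X. adj c b v u}"
    using X by linarith
  then show ?thesis
    using mono_wheel_of_large_degree[OF fin XV l _ v] near nearly_two_colored_commute by metis
qed

section \<open>Descent along the weights of the colours\<close>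

text \<open>A colour \<open>i\<close> has weight 0 on \<open>S\<close> if it does not occur there, and weight 1 if many vertices
  outside \<open>S\<close> are joined to \<open>S\<close> in colour \<open>i\<close>. A large biclique of colour \<open>i\<close> inside \<open>S\<close>
  lowers the weight of \<open>i\<close> on either side.\<close>

definition weight :: "('a set \<Rightarrow> nat) \<Rightarrow> 'a set \<Rightarrow> nat \<Rightarrow> 'a set \<Rightarrow> nat \<Rightarrow> nat" where
  "weight c V l S i =
    (if \<forall>x\<in>S. \<forall>y\<in>S. \<not> adj c i x y then 0
     else if \<exists>T\<subseteq>V. T \<inter> S = {} \<and> l \<le> card T \<and> (\<forall>x\<in>S. \<forall>y\<in>T. c {x, y} = i) then 1
     else 2)"

lemma weight_mono: "S' \<subseteq> S \<Longrightarrow> weight c V l S' i \<le> weight c V l S i"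
  unfolding weight_def by (auto split: if_splits) blast+

lemma weight_eq_0_iff: "weight c V l S i = 0 \<longleftrightarrow> (\<forall>x\<in>S. \<forall>y\<in>S. \<not> adj c i x y)"
  by (simp add: weight_def)

lemma weight_le_2: "weight c V l S i \<le> 2"
  by (simp add: weight_def)

text \<open>If an outside set is already joined to \<open>S\<close>, any vertex of it is a hub for
  all cycles in \<open>T \<union> S'\<close>. An \<open>i\<close>-edge in \<open>S'\<close> would
  supply the missing parity, so the colour vanishes from \<open>S'\<close>. Otherwise the weight is
  2, and \<open>T\<close> becomes an outside set for \<open>S'\<close>.\<close>

lemma weight_decreases:
  fixes l :: nat
  assumes fin: "finite V" and SV: "S \<subseteq> V" and l: "5 \<le> l" and nw: "\<not> mono_wheel c V l"
    and sub: "S' \<subseteq> S" "T \<subseteq> S" "S' \<inter> T = {}" and T: "l \<le> card T" and S': "l + 2 \<le> card S'"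
    and ST: "\<And>x y. x \<in> S' \<Longrightarrow> y \<in> T \<Longrightarrow> c {x, y} = i"
  shows "weight c V l S' i < weight c V l S i"
proof -
  have fins: "finite S'" "finite T" using sub SV fin by (meson finite_subset)+
  obtain x y where xy: "x \<in> S'" "y \<in> T" using S' T l by fastforce
  then have "adj c i x y" using ST sub by (auto simp: adj_def)
  then have occ: "\<not> (\<forall>x\<in>S. \<forall>y\<in>S. \<not> adj c i x y)" using xy sub by blast
  show ?thesis
  proof (cases "\<exists>T\<subseteq>V. T \<inter> S = {} \<and> l \<le> card T \<and> (\<forall>x\<in>S. \<forall>y\<in>T. c {x, y} = i)")
    case True
    then obtain T0 where T0: "T0 \<subseteq> V" "T0 \<inter> S = {}" "l \<le> card T0" "\<forall>x\<in>S. \<forall>y\<in>T0. c {x, y} = i"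
      by blast
    obtain h where h: "h \<in> T0" using T0(3) l by fastforce
    have "\<not> adj c i x y" if "x \<in> S'" "y \<in> S'" for x y
    proof
      assume "adj c i x y"
      have "has_cycle (adj c i) (T \<union> S') l"
      proof (rule has_cycle_bipartite)
        show "\<exists>x\<in>S'. \<exists>y\<in>S'. x \<noteq> y \<and> adj c i x y"
          using that \<open>adj c i x y\<close> by (auto simp: adj_def)
        show "adj c i x y" if "x \<in> T" "y \<in> S'" for x y
          using ST[of y x] that sub by (auto simp: adj_def insert_commute)
      qed (use fins T S' l symp_adj in auto)
      moreover have "adj c i h z" if "z \<in> T \<union> S'" for z
      proof -
        have "z \<in> S" using that sub by blast
        then have "c {z, h} = i" "h \<noteq> z" using T0(2,4) h by auto
        then show ?thesis by (simp add: adj_def insert_commute)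
      qed
      ultimately have "mono_wheel c V l"
        using h T0 sub SV by (intro mono_wheelI[of h V c i "T \<union> S'"]) auto
      then show False using nw by blast
    qed
    then have "weight c V l S' i = 0" by (simp add: weight_def)
    moreover have "weight c V l S i \<noteq> 0" using occ by (simp add: weight_def)
    ultimately show ?thesis by simp
  next
    case False
    have "\<exists>T\<subseteq>V. T \<inter> S' = {} \<and> l \<le> card T \<and> (\<forall>x\<in>S'. \<forall>y\<in>T. c {x, y} = i)"
      using sub SV T ST by (intro exI[of _ T]) blast
    then have "weight c V l S' i \<le> 1" by (simp add: weight_def)
    moreover have "weight c V l S i = 2" using occ False by (simp add: weight_def)
    ultimately show ?thesis by simp
  qed
qed

lemma mono_wheel_of_weight_le_1:
  fixes l :: nat
  assumes fin: "finite V" and SV: "S \<subseteq> V" and l: "5 \<le> l" and sub: "S' \<subseteq> S"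
    and near: "nearly_two_colored c a b l S'" and S': "16 * l \<le> card S'"
    and w: "weight c V l S a \<le> 1"
  shows "mono_wheel c V l"
proof -
  have fin': "finite S'" "S' \<subseteq> V" using fin SV sub by (auto intro: finite_subset)
  show ?thesis
  proof (cases "\<forall>x\<in>S. \<forall>y\<in>S. \<not> adj c a x y")
    case True
    then show ?thesis
      using sub fin' l near S' by (intro mono_wheel_of_absent_color[OF fin' _ near]) auto
  next
    case False
    then obtain T where "T \<subseteq> V" "T \<inter> S = {}" "l \<le> card T" "\<forall>x\<in>S. \<forall>y\<in>T. c {x, y} = a"
      using w by (auto simp: weight_def split: if_splits)
    then show ?thesis
      using sub by (intro mono_wheel_of_joined_set[OF fin fin'(2) l near S', of T]) auto
  qed
qed

text \<open>Induction on the total weight. The summand \<open>k * l\<close> absorbs the loss of each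
  step: \<open>card S \<le> 3 * card S' + k * l\<close> gives
  \<open>card S + k * l \<le> 3 * (card S' + k * l)\<close>.\<close>

lemma mono_wheel_of_gallai:
  fixes l :: nat
  assumes fin: "finite V" and g: "gallai c V"
    and col: "\<And>x y. x \<in> V \<Longrightarrow> y \<in> V \<Longrightarrow> x \<noteq> y \<Longrightarrow> c {x, y} < k"
    and k: "2 \<le> k" and l: "5 \<le> l"
    and "S \<subseteq> V" and "3 ^ (\<Sum>i<k. weight c V l S i) * (9 * l + k * l) \<le> card S + k * l"
  shows "mono_wheel c V l"
proof (rule ccontr)
  assume nw: "\<not> mono_wheel c V l"
  define B where "B = 9 * l + k * l"
  define P where "P S = (\<Sum>i<k. weight c V l S i)" for S
  have "\<not> 3 ^ P S * B \<le> card S + k * l" if "S \<subseteq> V" for S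
    using that
  proof (induction "P S" arbitrary: S rule: less_induct)
    case less
    have finS: "finite S" using less.prems fin finite_subset by blast
    show ?case
    proof
      assume card: "3 ^ P S * B \<le> card S + k * l"
      show False
      proof (cases "P S = 0")
        case True
        \<comment> \<open>At total weight 0 no colour occurs on \<open>S\<close>, yet two of its
          vertices are joined in some colour below \<open>k\<close>.\<close>
        then have "2 \<le> card S" using card l by (simp add: B_def)
        then obtain x y where xy: "x \<in> S" "y \<in> S" "x \<noteq> y"
          by (metis card_le_Suc0_iff_eq finS not_less_eq_eq numeral_2_eq_2)
        then have "weight c V l S (c {x, y}) = 0"
          using True col[of x y] less.prems by (auto simp: P_def)
        then have "\<not> adj c (c {x, y}) x y" using xy by (simp add: weight_eq_0_iff)
        then show False using xy(3) by (simp add: adj_def)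
      next
        case False
        have pow: "3 ^ j * B \<le> card S + k * l" if "j \<le> P S" for j
        proof -
          have "3 ^ j * B \<le> 3 ^ P S * B" using that by (intro mult_right_mono power_increasing) auto
          then show ?thesis using card by linarith
        qed
        have large: "27 * l + 2 * (k * l) \<le> card S" using pow[of 1] False by (simp add: B_def)
        then have S2: "k * l + 2 \<le> card S" using l by linarith
        have gS: "gallai c S" using g gallai_subset less.prems by blast
        have colS: "\<forall>x\<in>S. \<forall>y\<in>S. x \<noteq> y \<longrightarrow> c {x, y} < k"
          using col less.prems by blast
        from biclique_or_two_colors[OF finS gS colS k S2] show False
        proof (elim disjE exE conjE)
          fix S' T i
          assume 1: "S' \<subseteq> S" "T \<subseteq> S" "S' \<inter> T = {}" "l \<le> card T" "i < k"
            "\<forall>x\<in>S'. \<forall>y\<in>T. c {x, y} = i" "card S \<le> 3 * card S' + k * l"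
          have "l + 2 \<le> card S'" using 1(7) large l by linarith
          then have "weight c V l S' i < weight c V l S i"
            using 1 by (intro weight_decreases[OF fin less.prems l nw]) auto
          then have dec: "P S' < P S"
            unfolding P_def using 1(1,5) by (intro sum_strict_mono_ex1) (auto intro: weight_mono)
          have "3 * (3 ^ P S' * B) \<le> card S + k * l" using pow[of "Suc (P S')"] dec by simp
          then have "3 ^ P S' * B \<le> card S' + k * l" using 1(7) by linarith
          then show False using less.hyps[OF dec] 1(1) less.prems by blast
        next
          fix S' a b
          assume 2: "S' \<subseteq> S" "a < k" "b < k" "a \<noteq> b" "card S \<le> card S' + k * l"
            "nearly_two_colored c a b l S'"
          have S': "16 * l \<le> card S'" using 2(5) large by linarith
          \<comment> \<open>Both colours have weight 2, so the total is at least 4, and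
            \<open>3 ^ 4 * (9 * l) = 729 * l\<close> pays for \<open>665 * l\<close>.\<close>
          have "\<not> weight c V l S a \<le> 1" "\<not> weight c V l S b \<le> 1"
            using mono_wheel_of_weight_le_1[OF fin less.prems l 2(1) _ S'] 2(6) nw
              nearly_two_colored_commute by metis+
          then have "4 \<le> (\<Sum>i\<in>{a, b}. weight c V l S i)" using 2(4) by simp
          also have "\<dots> \<le> P S" unfolding P_def using 2(2,3) by (intro sum_mono2) auto
          finally have "665 * l \<le> card S'" using pow[of 4] 2(5) by (simp add: B_def)
          moreover have "finite S'" "S' \<subseteq> V" using 2(1) finS less.prems by (auto intro: finite_subset)
          ultimately show False using mono_wheel_of_two_colors[OF _ _ l 2(6)] nw by blast
        qed
      qed
    qed
  qed
  then show False using assms(6,7) by (simp add: P_def B_def)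
qed

section \<open>The bound\<close>

lemma gallai_if_no_rainbow_triangle:
  assumes "\<not> has_rainbow_copy (complete_graph m) c (complete_graph 3)"
  shows "gallai c {..<m}"
proof (rule ccontr)
  assume "\<not> gallai c {..<m}"
  then obtain x y z where xyz: "x < m" "y < m" "z < m" "x \<noteq> y" "y \<noteq> z" "x \<noteq> z"
    "c {x, y} \<noteq> c {y, z}" "c {y, z} \<noteq> c {x, z}" "c {x, y} \<noteq> c {x, z}"
    by (auto simp: gallai_def)
  define f where "f = (\<lambda>i::nat. if i = 0 then x else if i = 1 then y else z)"
  have lt3: "{..<3::nat} = {0, 1, 2}" by auto
  have edges3: "edges (complete_graph 3) = {{0, 1}, {1, 2}, {0, 2}}"
  proof
    show "edges (complete_graph 3) \<subseteq> {{0, 1}, {1, 2}, {0, 2}}"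
      by (auto simp: complete_graph_def lt3 nsets_def card_2_iff doubleton_eq_iff)
    show "{{0, 1}, {1, 2}, {0, 2}} \<subseteq> edges (complete_graph 3)"
      by (simp add: complete_graph_def nsets_def)
  qed
  have "is_copy f (complete_graph 3) (complete_graph m)"
    unfolding is_copy_def edges3 using xyz
    by (auto simp: complete_graph_def lt3 f_def inj_on_def nsets_def)
  moreover have "inj_on (\<lambda>e. c (f ` e)) (edges (complete_graph 3))"
    unfolding edges3 using xyz by (auto simp: f_def inj_on_def insert_commute)
  ultimately show False using assms by (auto simp: has_rainbow_copy_def)
qed

lemma monochromatic_wheel_copy:
  assumes "mono_wheel c {..<m} (n - 1)" "2 \<le> n"
  shows "has_monochromatic_copy (complete_graph m) c (wheel_graph n)"
proof -
  obtain i h xs where h: "h < m" and xs: "length xs = n - 1" "distinct xs"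
      "set xs \<subseteq> {x \<in> {..<m}. adj c i h x}" "successively (adj c i) xs" "adj c i (last xs) (hd xs)"
    using assms by (auto simp: mono_wheel_def has_cycle_def)
  define f where "f = (\<lambda>v::nat + nat. case v of Inl _ \<Rightarrow> h | Inr j \<Rightarrow> xs ! j)"
  have f [simp]: "f (Inl u) = h" "f (Inr j) = xs ! j" for u j by (auto simp: f_def)
  have nth: "xs ! j < m \<and> adj c i h (xs ! j)" if "j < n - 1" for j
  proof -
    have "xs ! j \<in> {x \<in> {..<m}. adj c i h x}" using xs(1,3) that by (metis nth_mem subsetD)
    then show ?thesis by simp
  qed
  have rim: "adj c i (xs ! j) (xs ! ((j + 1) mod (n - 1)))" if j: "j < n - 1" for j
  proof (cases "j + 1 < n - 1")
    case True
    then show ?thesis using xs(1,4) by (simp add: successively_conv_nth)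
  next
    case False
    \<comment> \<open>The last index wraps around to 0, and the rim edge is the one closing the
      list.\<close>
    then have "j = n - 2" "xs \<noteq> []" using j xs(1) by auto
    then show ?thesis using xs(1,5) j by (simp add: last_conv_nth hd_conv_nth Suc_diff_Suc numeral_2_eq_2)
  qed
  have E0: "edges (complete_graph 1) = {}"
    by (auto simp: complete_graph_def nsets_def card_2_iff)
  have edge: "f ` e \<in> edges (complete_graph m) \<and> c (f ` e) = i" if e: "e \<in> edges (wheel_graph n)" for e
  proof -
    consider j where "j < n - 1" "e = {Inr j, Inr ((j + 1) mod (n - 1))}"
      | u j where "j < n - 1" "e = {Inl u, Inr j}"
      using e E0 by (auto simp: wheel_graph_def graph_join_def cycle_graph_def)
    then show ?thesis
    proof cases
      case 1
      have "(j + 1) mod (n - 1) < n - 1" using 1(1) by simp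
      then show ?thesis
        using rim[OF 1(1)] nth[OF 1(1)] nth[of "(j + 1) mod (n - 1)"] 1(2)
        by (simp add: complete_graph_def nsets_def adj_def card_2_iff')
    next
      case 2
      then show ?thesis using nth[OF 2(1)] h
        by (simp add: complete_graph_def nsets_def adj_def)
    qed
  qed
  have verts: "verts (wheel_graph n) = {..<1} <+> {..<n - 1}"
    by (simp add: wheel_graph_def graph_join_def cycle_graph_def complete_graph_def)
  have "inj_on f (verts (wheel_graph n))"
    unfolding verts using nth xs(1,2)
    by (fastforce simp: inj_on_def adj_def nth_eq_iff_index_eq)
  moreover have "f ` verts (wheel_graph n) \<subseteq> verts (complete_graph m)"
    unfolding verts using nth h by (auto simp: complete_graph_def)
  ultimately have "is_copy f (wheel_graph n) (complete_graph m)"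
    using edge by (simp add: is_copy_def)
  then show ?thesis using edge unfolding has_monochromatic_copy_def by metis
qed

text \<open>The estimate is the product of one in \<open>k\<close> and one in \<open>l\<close>,
  divided by 20. Raising \<open>k\<close> multiplies the left side of the first by at most 18, the
  right side by 30; the second, \<open>4 * l \<le> 5 * (l - 3)\<^sup>2\<close>, is an equality at
  \<open>l = 5\<close>.\<close>

lemma weight_bound_le:
  fixes k l :: nat
  assumes "3 \<le> k" "5 \<le> l"
  shows "9 ^ k * (9 * l + k * l) \<le> (l - 3)\<^sup>2 * 30 ^ k"
proof -
  have k: "5 * (9 + k) * 9 ^ k \<le> 4 * 30 ^ k"
    using assms(1)
  proof (induction k rule: dec_induct)
    case base
    then show ?case by simp
  next
    case (step k)
    have "5 * (9 + Suc k) * 9 ^ Suc k \<le> 5 * (2 * (9 + k)) * 9 ^ Suc k"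
      by (intro mult_right_mono) auto
    also have "\<dots> = 18 * (5 * (9 + k) * 9 ^ k)" by simp
    also have "\<dots> \<le> 30 * (4 * 30 ^ k)" by (intro mult_le_mono step.IH) simp
    finally show ?case by simp
  qed
  obtain j where j: "l = j + 5" using assms(2) le_Suc_ex by (metis add.commute)
  have "4 * l \<le> 5 * (l - 3)\<^sup>2" by (simp add: j power2_eq_square algebra_simps)
  then have "4 * l * (5 * (9 + k) * 9 ^ k) \<le> 5 * (l - 3)\<^sup>2 * (4 * 30 ^ k)"
    using k by (rule mult_mono) auto
  then have "20 * (9 ^ k * (9 * l + k * l)) \<le> 20 * ((l - 3)\<^sup>2 * 30 ^ k)"
    by (simp add: algebra_simps)
  then show ?thesis by simp
qed

theorem theorem9:
  fixes k n :: nat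
  assumes "k \<ge> 3" and "n \<ge> 6"
  shows "gallai_ramsey k (complete_graph 3) (wheel_graph n)
    \<le> enat ((n - 4)\<^sup>2 * 30 ^ k + k * (n - 1))"
proof -
  define m where "m = (n - 4)\<^sup>2 * 30 ^ k + k * (n - 1)"
  have "has_monochromatic_copy (complete_graph m) c (wheel_graph n)"
    if c: "edge_coloring (complete_graph m) k c"
      and nr: "\<not> has_rainbow_copy (complete_graph m) c (complete_graph 3)" for c
  proof (rule monochromatic_wheel_copy)
    \<comment> \<open>Each colour starts with weight at most 2, which accounts for the factor
      \<open>3 ^ (2 * k) = 9 ^ k\<close>.\<close>
    have "(\<Sum>i<k. weight c {..<m} (n - 1) {..<m} i) \<le> (\<Sum>i<k. 2)"
      by (intro sum_mono weight_le_2)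
    then have "(3::nat) ^ (\<Sum>i<k. weight c {..<m} (n - 1) {..<m} i) \<le> 3 ^ (2 * k)"
      by (intro power_increasing) auto
    also have "\<dots> = 9 ^ k" by (simp add: power_mult)
    finally have "3 ^ (\<Sum>i<k. weight c {..<m} (n - 1) {..<m} i) * (9 * (n - 1) + k * (n - 1))
        \<le> 9 ^ k * (9 * (n - 1) + k * (n - 1))" by (rule mult_right_mono) simp
    also have "\<dots> \<le> (n - 1 - 3)\<^sup>2 * 30 ^ k" using assms by (intro weight_bound_le) auto
    also have "\<dots> \<le> card {..<m} + k * (n - 1)" by (simp add: m_def)
    finally show "mono_wheel c {..<m} (n - 1)"
    proof (rule mono_wheel_of_gallai[rotated -1])
      show "gallai c {..<m}" using nr by (rule gallai_if_no_rainbow_triangle)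
      show "c {x, y} < k" if "x \<in> {..<m}" "y \<in> {..<m}" "x \<noteq> y" for x y
        using c that by (auto simp: edge_coloring_def complete_graph_def nsets_def image_subset_iff)
    qed (use assms in auto)
  qed (use assms in auto)
  then have "enat m \<in> {enat m | m. \<forall>c. edge_coloring (complete_graph m) k c \<longrightarrow>
      has_rainbow_copy (complete_graph m) c (complete_graph 3) \<or>
      has_monochromatic_copy (complete_graph m) c (wheel_graph n)}"
    by blast
  then show ?thesis unfolding gallai_ramsey_def m_def[symmetric] by (rule Inf_lower)
qed

end
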